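(* Let $G$ be a $k$-colorable graph. Then for every assignment to the vertices of $G$ of lists $L(v)=\{\gamma(v),\gamma(v)+1,\dots,\gamma(v)+k-1\}$, each an interval of $k$ consecutive integers, $G$ admits a proper coloring $c$ with $c(v)\in L(v)$ for all $v\in V(G)$. Consequently every $k$-colorable graph is $k$-$(\gamma,\mu)$-colorable.
   Context: A graph is $k$-$(\gamma,\mu)$-colorable if it admits a proper coloring selecting one color from each list under every assignment of integer intervals $[\gamma(v),\mu(v)]$ with $\mu(v)-\gamma(v)+1=k$ to its vertices. *)

theory Defs
  imports "Graph_Theory.Pair_Digraph"
begin

text \<open>
  A simple graph, not necessarily finite, is a \<^locale>\<open>pair_bidirected_digraph\<close>: its arc set is
  symmetric, loop-free and contained in the square of the vertex set. An undirected edge \<open>uv\<close>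
  is thus the pair of arcs \<open>(u, v)\<close> and \<open>(v, u)\<close>. The locale for finite graphs,
  \<^locale>\<open>pair_graph\<close>, is a special case.
\<close>

definition proper_coloring :: "'a pair_pre_digraph \<Rightarrow> ('a \<Rightarrow> 'c) \<Rightarrow> bool" where
  "proper_coloring G c \<longleftrightarrow> (\<forall>(u, v) \<in> parcs G. c u \<noteq> c v)"

definition list_coloring :: "'a pair_pre_digraph \<Rightarrow> ('a \<Rightarrow> 'c set) \<Rightarrow> ('a \<Rightarrow> 'c) \<Rightarrow> bool" where
  "list_coloring G L c \<longleftrightarrow> proper_coloring G c \<and> (\<forall>v \<in> pverts G. c v \<in> L v)"

definition k_colorable :: "nat \<Rightarrow> 'a pair_pre_digraph \<Rightarrow> bool" where
  "k_colorable k G \<longleftrightarrow>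
    (\<exists>f :: 'a \<Rightarrow> nat. proper_coloring G f \<and> (\<forall>v \<in> pverts G. f v \<in> {1..k}))"

definition k_gamma_mu_colorable :: "nat \<Rightarrow> 'a pair_pre_digraph \<Rightarrow> bool" where
  "k_gamma_mu_colorable k G \<longleftrightarrow>
    (\<forall>\<gamma> \<mu> :: 'a \<Rightarrow> int. (\<forall>v \<in> pverts G. \<mu> v - \<gamma> v + 1 = int k) \<longrightarrow>
      (\<exists>c. list_coloring G (\<lambda>v. {\<gamma> v..\<mu> v}) c))"

end

theory Submission
  imports Defs
begin

text \<open>
  An interval of \<open>k\<close> consecutive integers contains exactly one representative of each residue
  class modulo \<open>k\<close>. So pick in every list the representative of the colour that a fixed
  \<open>k\<close>-colouring assigns to the vertex.
\<close>

text \<open>Two elements of \<open>{1..k}\<close> are less than \<open>k\<close> apart, so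
  \<open>k\<close> divides their difference only if it is 0.\<close>

lemma mod_neq_if_neq_in_1_to_k:
  fixes a b k :: nat
  assumes "a \<in> {1..k}" "b \<in> {1..k}" "a \<noteq> b"
  shows "int a mod int k \<noteq> int b mod int k"
proof
  assume "int a mod int k = int b mod int k"
  then have "int k dvd int a - int b"
    by (simp add: mod_eq_dvd_iff)
  moreover have "\<bar>int a - int b\<bar> < int k" "int a - int b \<noteq> 0"
    using assms by auto
  ultimately show False
    using dvd_imp_le_int[of "int a - int b" "int k"] by simp
qed

text \<open>\<open>L\<close> enters only through an equation on the vertices, so that both halves of
  the theorem are instances: arbitrary lists \<open>L\<close>, and the intervals from
  \<open>\<gamma> v\<close> to \<open>\<mu> v\<close>.\<close>

lemma k_colorable_imp_interval_list_coloring: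
  fixes \<gamma> :: "'a \<Rightarrow> int"
  assumes "pair_wf_digraph G"
    and "k_colorable k G"
    and L: "\<And>v. v \<in> pverts G \<Longrightarrow> L v = {\<gamma> v..\<gamma> v + int k - 1}"
  shows "\<exists>c. list_coloring G L c"
proof -
  interpret pair_wf_digraph G by fact
  obtain f :: "'a \<Rightarrow> nat" where proper: "proper_coloring G f"
    and range: "\<And>v. v \<in> pverts G \<Longrightarrow> f v \<in> {1..k}"
    using assms(2) unfolding k_colorable_def by blast
  \<comment> \<open>For \<open>k > 0\<close> this is the least integer from
    \<open>\<gamma> v\<close> on that is congruent to \<open>f v\<close> modulo
    \<open>k\<close>.\<close>
  define c where "c v = \<gamma> v + (int (f v) - \<gamma> v) mod int k" for v
  have c_mod: "c v mod int k = int (f v) mod int k" for v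
    unfolding c_def by (simp add: mod_add_right_eq)
  have "c u \<noteq> c v" if "(u, v) \<in> parcs G" for u v
  proof -
    \<comment> \<open>The bound on \<open>f\<close> is known on vertices only; well-formedness makes
      both ends of an arc vertices.\<close>
    have "u \<in> pverts G" "v \<in> pverts G"
      using that in_arcsD1 in_arcsD2 by blast+
    moreover have "f u \<noteq> f v"
      using proper that unfolding proper_coloring_def by blast
    ultimately have "int (f u) mod int k \<noteq> int (f v) mod int k"
      using range mod_neq_if_neq_in_1_to_k by blast
    then show ?thesis
      using c_mod[of u] c_mod[of v] by auto
  qed
  moreover have "c v \<in> L v" if "v \<in> pverts G" for v
  proof -
    \<comment> \<open>A vertex has a colour in \<open>{1..k}\<close>, which excludes
      \<open>k = 0\<close>. Hence the offset in \<open>c v\<close> lies between 0 and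
      \<open>k - 1\<close>.\<close>
    have "int k > 0"
      using range[OF that] by auto
    then show ?thesis
      using pos_mod_bound[of "int k" "int (f v) - \<gamma> v"] by (simp add: L[OF that] c_def)
  qed
  ultimately show ?thesis
    unfolding list_coloring_def proper_coloring_def by blast
qed

theorem theorem4:
  fixes G :: "'a pair_pre_digraph" and k :: nat
  assumes "pair_bidirected_digraph G"
    and "k_colorable k G"
  shows "(\<forall>(\<gamma> :: 'a \<Rightarrow> int) (L :: 'a \<Rightarrow> int set).
            (\<forall>v \<in> pverts G. L v = {\<gamma> v..\<gamma> v + int k - 1}) \<longrightarrow>
            (\<exists>c :: 'a \<Rightarrow> int. list_coloring G L c))
         \<and> k_gamma_mu_colorable k G"
proof -
  have "pair_wf_digraph G"
    using assms(1) pair_bidirected_digraph.axioms(2) pair_loopfree_digraph.axioms(1) by blast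
  note coloring = k_colorable_imp_interval_list_coloring[OF this assms(2)]
  show ?thesis
    unfolding k_gamma_mu_colorable_def
  proof (intro conjI allI impI)
    fix \<gamma> :: "'a \<Rightarrow> int" and L :: "'a \<Rightarrow> int set"
    assume "\<forall>v \<in> pverts G. L v = {\<gamma> v..\<gamma> v + int k - 1}"
    then show "\<exists>c. list_coloring G L c"
      by (intro coloring[of L \<gamma>]) simp
  next
    fix \<gamma> \<mu> :: "'a \<Rightarrow> int"
    assume width: "\<forall>v \<in> pverts G. \<mu> v - \<gamma> v + 1 = int k"
    show "\<exists>c. list_coloring G (\<lambda>v. {\<gamma> v..\<mu> v}) c"
    \<comment> \<open>The width condition fixes the right end as
      \<open>\<gamma> v + int k - 1\<close>, which gives the list equation.\<close>
    proof (rule coloring)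
      fix v assume "v \<in> pverts G"
      then have "\<mu> v - \<gamma> v + 1 = int k"
        using width by blast
      then have "\<mu> v = \<gamma> v + int k - 1"
        by linarith
      then show "{\<gamma> v..\<mu> v} = {\<gamma> v..\<gamma> v + int k - 1}"
        by simp
    qed
  qed
qed

end
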